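(* Let $\rho_{ABC}\in M_2(\mathbb{C})\otimes M_2(\mathbb{C})\otimes M_2(\mathbb{C})$ be a three-qubit state. Let $\{M_{a|0}\}_{a=0}^1,\{M_{a|1}\}_{a=0}^1$ be two POVMs on subsystem $A$ and $\{N_{b|0}\}_{b=0}^1,\{N_{b|1}\}_{b=0}^1$ two POVMs on subsystem $B$, and define $\sigma_{ab|xy}=\mathrm{Tr}_{AB}\big((M_{a|x}\otimes N_{b|y}\otimes\mathbb{1})\rho_{ABC}\big)$ for $a,b,x,y\in\{0,1\}$. If $\mathrm{rank}(\rho_{ABC})\ge3$, then $\Sigma=\{\sigma_{ab|xy}\}$ is not on the edge of the set of no-signaling assemblages.
   Context: Scenario with two untrusted parties, binary outcomes $a,b\in\{0,1\}$ and binary settings $x,y\in\{0,1\}$, trusted system $\mathbb{C}^d$ (here $d=2$). A no-signaling assemblage is a collection of positive semidefinite operators $\sigma_{ab|xy}$ on $\mathbb{C}^d$ with $\sum_{a,b}\sigma_{ab|xy}=\rho$ independent of $x,y$ and of trace one, $\sum_b\sigma_{ab|xy}$ independent of $y$, and $\sum_a\sigma_{ab|xy}$ independent of $x$ (the assemblage defined in the claim is of this kind). An LHS assemblage is one of the form $\sigma_{ab|xy}=\sum_j q_j p_j(a|x)p'_j(b|y)\rho_j$ with probability weights $q_j$, density operators $\rho_j$ and conditional probability distributions $p_j,p'_j$. A no-signaling assemblage $\Sigma$ is on the edge of the set of no-signaling assemblages if whenever $\Sigma=\epsilon\Sigma_1+(1-\epsilon)\Sigma_2$ with $\epsilon\in[0,1]$,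 $\Sigma_1$ LHS and $\Sigma_2$ no-signaling, necessarily $\epsilon=0$. *)

theory Defs
  imports "HOL-Analysis.Analysis"
begin

text \<open>Operators on C^n are represented as complex^'n^'n (row index first).
  Qubit index type: 2. Three-qubit index type: 2 * 2 * 2 (ordering A, B, C).\<close>

definition psd :: "complex^'n^'n \<Rightarrow> bool" where
  "psd A \<longleftrightarrow> (\<forall>v :: complex^'n.
     Im (\<Sum>i\<in>UNIV. \<Sum>j\<in>UNIV. cnj (v$i) * A$i$j * v$j) = 0 \<and>
     Re (\<Sum>i\<in>UNIV. \<Sum>j\<in>UNIV. cnj (v$i) * A$i$j * v$j) \<ge> 0)"

definition density :: "complex^'n^'n \<Rightarrow> bool" where
  "density \<rho> \<longleftrightarrow> psd \<rho> \<and> trace \<rho> = 1"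

definition povm :: "(2 \<Rightarrow> complex^2^2) \<Rightarrow> bool" where
  "povm M \<longleftrightarrow> (\<forall>a. psd (M a)) \<and> (\<Sum>a\<in>UNIV. M a) = mat 1"

definition kron3_id :: "complex^2^2 \<Rightarrow> complex^2^2 \<Rightarrow> complex^(2\<times>2\<times>2)^(2\<times>2\<times>2)" where
  "kron3_id M N = (\<chi> r. \<chi> s. (case r of (i,j,k) \<Rightarrow> case s of (i',j',k') \<Rightarrow>
        M$i$i' * N$j$j' * (if k = k' then 1 else 0)))"

definition ptrace_AB :: "complex^(2\<times>2\<times>2)^(2\<times>2\<times>2) \<Rightarrow> complex^2^2" where
  "ptrace_AB T = (\<chi> k. \<chi> k'. \<Sum>i\<in>UNIV. \<Sum>j\<in>UNIV. T$(i,j,k)$(i,j,k'))"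

text \<open>Assemblages: S a b x y = sigma_{ab|xy}, outcomes 'o, settings 's, trusted system C^'d.\<close>
definition no_signaling ::
  "('o::finite \<Rightarrow> 'o \<Rightarrow> 's \<Rightarrow> 's \<Rightarrow> complex^'d^'d) \<Rightarrow> bool" where
  "no_signaling S \<longleftrightarrow>
     (\<forall>a b x y. psd (S a b x y)) \<and>
     (\<exists>\<rho>. trace \<rho> = 1 \<and> (\<forall>x y. (\<Sum>a\<in>UNIV. \<Sum>b\<in>UNIV. S a b x y) = \<rho>)) \<and>
     (\<forall>a x y y'. (\<Sum>b\<in>UNIV. S a b x y) = (\<Sum>b\<in>UNIV. S a b x y')) \<and>
     (\<forall>b x x' y. (\<Sum>a\<in>UNIV. S a b x y) = (\<Sum>a\<in>UNIV. S a b x' y))"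

definition LHS ::
  "('o::finite \<Rightarrow> 'o \<Rightarrow> 's \<Rightarrow> 's \<Rightarrow> complex^'d^'d) \<Rightarrow> bool" where
  "LHS S \<longleftrightarrow> (\<exists>(J :: nat set) (q :: nat \<Rightarrow> real) (\<rho> :: nat \<Rightarrow> complex^'d^'d)
       (p :: nat \<Rightarrow> 'o \<Rightarrow> 's \<Rightarrow> real) (p' :: nat \<Rightarrow> 'o \<Rightarrow> 's \<Rightarrow> real).
     finite J \<and> (\<forall>j\<in>J. q j \<ge> 0) \<and> (\<Sum>j\<in>J. q j) = 1 \<and>
     (\<forall>j\<in>J. density (\<rho> j)) \<and>
     (\<forall>j\<in>J. \<forall>a x. p j a x \<ge> 0) \<and> (\<forall>j\<in>J. \<forall>x. (\<Sum>a\<in>UNIV. p j a x) = 1) \<and>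
     (\<forall>j\<in>J. \<forall>b y. p' j b y \<ge> 0) \<and> (\<forall>j\<in>J. \<forall>y. (\<Sum>b\<in>UNIV. p' j b y) = 1) \<and>
     (\<forall>a b x y. S a b x y = (\<Sum>j\<in>J. (q j * p j a x * p' j b y) *\<^sub>R \<rho> j)))"

definition on_edge ::
  "('o::finite \<Rightarrow> 'o \<Rightarrow> 's \<Rightarrow> 's \<Rightarrow> complex^'d^'d) \<Rightarrow> bool" where
  "on_edge S \<longleftrightarrow> no_signaling S \<and>
     (\<forall>(\<epsilon>::real) S1 S2. 0 \<le> \<epsilon> \<and> \<epsilon> \<le> 1 \<and> LHS S1 \<and> no_signaling S2 \<and>
        (\<forall>a b x y. S a b x y = \<epsilon> *\<^sub>R S1 a b x y + (1 - \<epsilon>) *\<^sub>R S2 a b x y)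
        \<longrightarrow> \<epsilon> = 0)"

end

theory Submission
  imports Defs
begin

text \<open>
  It suffices to find deterministic outcomes \<open>f x\<close>, \<open>g y\<close> and one vector \<open>v \<noteq> 0\<close> lying in the ranges
  of all four operators \<open>\<sigma>\<close> with outcomes \<open>f x\<close>, \<open>g y\<close>: a small multiple of \<open>v v\<^sup>*\<close> can then be split
  off as a deterministic, hence LHS, part. Diagonalizing each POVM reduces this to rank-one effects: if
  \<open>e\<close>, \<open>h\<close> are eigenvectors and \<open>z\<close> is arbitrary, then contracting \<open>\<rho> z\<close> with \<open>e \<otimes> h\<close> gives a vector in
  the range of \<open>\<sigma>\<close>.

  Let \<open>W\<close> be a three-dimensional subspace of the range of \<open>\<rho>\<close>, and call an eigenvector of one party
  injective if contraction with it is injective on \<open>W\<close>. If \<open>a\<close> is injective, the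
  contractions of \<open>W\<close> with \<open>a \<otimes> b\<close> fill the qubit for all but at most one direction \<open>b\<close>, and are never
  zero. So if one party has an injective eigenvector for each setting, take \<open>v\<close> in the exceptional line
  for the first setting and let the other party avoid the exceptional direction of the second.
  Otherwise, for some pair of settings, every eigenvector of either party annihilates a nonzero vector
  of \<open>W\<close>. These four vectors are linearly dependent, which either produces a fully product vector
  in \<open>W\<close>, or ties their components together so that \<open>v\<close> can be taken to be one of them.
\<close>

section \<open>Contractions of a three-dimensional space of three-qubit vectors\<close>

lemma nontrivial_kernel:
  fixes A :: "'k::field^'n^'m"
  assumes "CARD('m) < CARD('n)"
  obtains c where "c \<noteq> 0" "A *v c = 0"
proof -
  have "\<not> inj ((*v) A)"
  proof
    assume "inj ((*v) A)"
    then have "vec.dim (range ((*v) A)) = vec.dim (UNIV :: ('k^'n) set)"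
      by (intro vec.dim_image_eq matrix_vector_mul_linear_gen) auto
    moreover have "vec.dim (range ((*v) A)) \<le> CARD('m)"
      by (rule dim_subset_UNIV_cart_gen)
    ultimately show False
      using assms vec_dim_card by (metis not_le)
  qed
  then obtain c d where "c \<noteq> d" "A *v c = A *v d"
    by (auto simp: inj_def)
  then show thesis
    by (intro that[of "c - d"]) (auto simp: matrix_vector_mult_diff_distrib)
qed

section \<open>Two-by-two determinants as a test for linear independence\<close>

definition det2 :: "'k::comm_ring^2 \<Rightarrow> 'k^2 \<Rightarrow> 'k" where
  "det2 a b = a$1 * b$2 - a$2 * b$1"

lemma det2_swap: "det2 b a = - det2 a b"
  by (simp add: det2_def mult.commute)

lemma det2_self [simp]: "det2 a a = 0"
  by (simp add: det2_def mult.commute)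

text \<open>Cramer's rule: the quotients are the coordinates of \<open>b\<close> in the basis
  \<open>a\<close>, \<open>a'\<close>. Later scalars of the form \<open>det2 _ _ / det2 _ _\<close>
  are such coordinates.\<close>

lemma det2_expand:
  fixes a a' b :: "'k::field^2"
  assumes "det2 a a' \<noteq> 0"
  shows "b = (det2 b a' / det2 a a') *s a + (det2 a b / det2 a a') *s a'"
proof -
  have "(b$i) * det2 a a' = det2 b a' * a$i + det2 a b * a'$i" for i
    using exhaust_2[of i] by (auto simp: det2_def algebra_simps)
  then show ?thesis
    using assms by (simp add: vec_eq_iff field_simps)
qed

lemma det2_eq_0_imp_scale:
  fixes z z' :: "'k::field^2"
  assumes "det2 z z' = 0" "z \<noteq> 0"
  shows "\<exists>t. z' = t *s z"
proof -
  consider "z$1 \<noteq> 0" | "z$2 \<noteq> 0"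
    using assms(2) by (metis (full_types) exhaust_2 vec_eq_iff zero_index)
  then show ?thesis
  proof cases
    case 1
    then show ?thesis using assms(1)
      by (intro exI[of _ "z'$1 / z$1"]) (auto simp: vec_eq_iff forall_2 det2_def field_simps)
  next
    case 2
    then show ?thesis using assms(1)
      by (intro exI[of _ "z'$2 / z$2"]) (auto simp: vec_eq_iff forall_2 det2_def field_simps)
  qed
qed

lemma det2_nonzero_coordinate:
  fixes a u u' :: "'k::field^2"
  assumes "a \<noteq> 0" "det2 u u' \<noteq> 0"
  shows "det2 u a \<noteq> 0 \<or> det2 u' a \<noteq> 0"
proof (rule ccontr)
  assume "\<not> ?thesis"
  moreover have "u \<noteq> 0" using assms(2) by (auto simp: det2_def)
  ultimately obtain t where t: "a = t *s u" and "det2 u' a = 0"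
    using det2_eq_0_imp_scale by blast
  moreover have "det2 u' (t *s u) = - (t * det2 u u')" by (simp add: det2_def algebra_simps)
  ultimately show False using assms t by simp
qed

lemma det2_complement:
  fixes b :: "'k::field^2"
  assumes "b \<noteq> 0"
  obtains b' where "det2 b b' \<noteq> 0"
proof -
  have "det2 (axis 1 1) (axis 2 1 :: 'k^2) \<noteq> 0" 
    by (simp add: det2_def axis_def)
  with det2_nonzero_coordinate[OF assms this] that show thesis
    by (metis det2_swap neg_equal_0_iff_equal)
qed

text \<open>\<open>C a b c\<close> models the contraction with \<open>a\<close> and \<open>b\<close> of the vector of \<open>W\<close> with coordinates \<open>c\<close>.\<close>

locale trilinear_block =
  fixes C :: "'k::field^2 \<Rightarrow> 'k^2 \<Rightarrow> 'k^3 \<Rightarrow> 'k^2"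
  assumes lin_left: "C (s *s a + t *s a') b c = s *s C a b c + t *s C a' b c"
    and lin_mid: "C a (s *s b + t *s b') c = s *s C a b c + t *s C a b' c"
    and lin_right: "C a b (s *s c + t *s c') = s *s C a b c + t *s C a b c'"
    and nondegenerate: "(\<And>a b. C a b c = 0) \<Longrightarrow> c = 0"
begin

text \<open>The two parties enter symmetrically, so every result about rows also yields its column
  version through this interpretation.\<close>

lemma swap: "trilinear_block (\<lambda>a b. C b a)"
  by standard (auto simp: lin_left lin_mid lin_right intro: nondegenerate)

lemma scale_left: "C (s *s a) b c = s *s C a b c"
  using lin_left[of s a 0 0 b c] by simp

lemma scale_mid: "C a (s *s b) c = s *s C a b c"
  using lin_mid[of a s b 0 0 c] by simp

lemma scale_right: "C a b (s *s c) = s *s C a b c"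
  using lin_right[of a b s c 0 0] by simp

lemma add_right: "C a b (c + c') = C a b c + C a b c'"
  using lin_right[of a b 1 c 1 c'] by simp

lemma zero_right [simp]: "C a b 0 = 0"
  using scale_right[of a b 0 0] by simp

lemma range_combination:
  assumes "v \<in> range (C a b)" "v' \<in> range (C a b)"
  shows "s *s v + t *s v' \<in> range (C a b)"
  using assms lin_right by (auto simp flip: lin_right)

lemma range_scale_iff:
  assumes "s \<noteq> 0"
  shows "s *s v \<in> range (C a b) \<longleftrightarrow> v \<in> range (C a b)"
proof
  assume "s *s v \<in> range (C a b)"
  from range_combination[OF this this, of "1 / s" 0] show "v \<in> range (C a b)"
    using assms by simp
next
  assume "v \<in> range (C a b)"
  from range_combination[OF this this, of s 0] show "s *s v \<in> range (C a b)" by simp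
qed

lemma independent_in_range_surj:
  assumes "z \<in> range (C a b)" "z' \<in> range (C a b)" "det2 z z' \<noteq> 0"
  shows "surj (C a b)"
proof -
  have "p \<in> range (C a b)" for p
    using range_combination[OF assms(1,2)] det2_expand[OF assms(3), of p] by metis
  then show ?thesis by auto
qed

lemma right_expand: "C a b c = (\<Sum>i\<in>UNIV. c$i *s C a b (axis i 1))"
proof -
  have eq: "c = c$1 *s axis 1 1 + 1 *s (c$2 *s axis 2 1 + c$3 *s axis 3 1)"
    by (simp add: vec_eq_iff forall_3 axis_def)
  show ?thesis
    by (subst eq, subst lin_right, subst lin_right) (simp add: sum_3 add.assoc)
qed

lemma kernel:
  obtains c where "c \<noteq> 0" "C a b c = 0"
proof -
  define A :: "'k^3^2" where "A = (\<chi> j i. C a b (axis i 1) $ j)"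
  obtain c where "c \<noteq> 0" "A *v c = 0" using nontrivial_kernel[of A] by auto
  moreover have "A *v c = C a b c"
    by (subst right_expand) (simp add: vec_eq_iff matrix_vector_mult_def A_def mult.commute)
  ultimately show thesis using that by auto
qed

text \<open>A map into a plane that is not onto has its range in a line spanned by some
  \<open>z\<close>, so it is a linear functional times \<open>z\<close>; the coefficients of the
  functional are read off on the standard basis.\<close>

lemma not_surj_rank_one:
  assumes "\<not> surj (C a b)"
  obtains d :: "'k^3" and z where "\<And>c. C a b c = (\<Sum>i\<in>UNIV. d$i * c$i) *s z"
proof (cases "\<exists>c. C a b c \<noteq> 0")
  case False
  then show thesis by (intro that[of _ 0]) auto
next
  case True
  then obtain z where z: "z \<in> range (C a b)" "z \<noteq> 0" by auto
  have "\<exists>t. C a b (axis i 1) = t *s z" for i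
    using independent_in_range_surj[OF z(1)] assms det2_eq_0_imp_scale[OF _ z(2)] by blast
  then obtain t where t: "\<And>i. C a b (axis i 1) = t i *s z" by metis
  show thesis
    by (rule that[of "\<chi> i. t i" z])
      (subst right_expand, simp add: t sum_3 algebra_simps vec.scale_left_distrib)
qed

section \<open>Vectors whose contraction is injective on the three-dimensional space\<close>

definition row_injective :: "'k^2 \<Rightarrow> bool" where
  "row_injective a \<longleftrightarrow> (\<forall>c. (\<forall>b. C a b c = 0) \<longrightarrow> c = 0)"

lemma row_injectiveD:
  assumes "row_injective a" "det2 b b' \<noteq> 0" "C a b c = 0" "C a b' c = 0"
  shows "c = 0"
proof -
  have "C a b'' c = 0" for b''
    using assms(3,4) by (subst det2_expand[OF assms(2), of b'']) (simp only: lin_mid, simp)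
  then show ?thesis using assms(1) by (auto simp: row_injective_def)
qed

text \<open>If both contractions failed to be onto, each would be governed by one functional. Two
  functionals on a three-dimensional space have a common nonzero zero, which injectivity of
  \<open>a\<close> forbids. Hence at most one direction of \<open>b\<close> is exceptional.\<close>

lemma row_injective_surj:
  assumes "row_injective a" "det2 b b' \<noteq> 0"
  shows "surj (C a b) \<or> surj (C a b')"
proof (rule ccontr)
  assume "\<not> ?thesis"
  then obtain d d' z z' where
    d: "\<And>c. C a b c = (\<Sum>i\<in>UNIV. d$i * c$i) *s z" and
    d': "\<And>c. C a b' c = (\<Sum>i\<in>UNIV. d'$i * c$i) *s z'"
    by (metis not_surj_rank_one)
  define A :: "'k^3^2" where "A = (\<chi> j. if j = 1 then d else d')"
  obtain c where c: "c \<noteq> 0" "A *v c = 0" using nontrivial_kernel[of A] by auto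
  then have "(A *v c)$1 = 0" "(A *v c)$2 = 0" by auto
  then have "C a b c = 0" "C a b' c = 0"
    unfolding d d' by (auto simp: A_def matrix_vector_mult_def)
  then show False using row_injectiveD[OF assms] c by blast
qed

lemma row_injective_common:
  assumes "row_injective a"
  obtains v where "v \<noteq> 0" "\<And>b. b \<noteq> 0 \<Longrightarrow> v \<in> range (C a b)"
proof (cases "\<forall>b. b \<noteq> 0 \<longrightarrow> surj (C a b)")
  case True
  then show thesis by (intro that[of "axis 1 1"]) (auto simp: axis_eq_0_iff)
next
  case False
  then obtain b where b: "b \<noteq> 0" "\<not> surj (C a b)" by auto
  obtain b' where b': "det2 b b' \<noteq> 0" using det2_complement[OF b(1)] .
  \<comment> \<open>Taking \<open>c\<close> in the kernel for \<open>b'\<close> forces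
    \<open>C a b c\<close> to be nonzero. This vector spans the range in the exceptional direction
    \<open>b\<close>, and all directions other than \<open>b\<close> are onto.\<close>
  obtain c where "c \<noteq> 0" "C a b' c = 0" using kernel .
  with row_injectiveD[OF assms b'] have "C a b c \<noteq> 0" by blast
  moreover have "C a b c \<in> range (C a b'')" if "b'' \<noteq> 0" for b''
  proof (cases "det2 b b'' = 0")
    case True
    then obtain t where t: "b'' = t *s b" using det2_eq_0_imp_scale b by blast
    with that have "t \<noteq> 0" by auto
    then have "C a b c = C a b'' ((1 / t) *s c)" 
      by (simp add: t scale_mid scale_right)
    then show ?thesis by blast
  next
    case False
    then have "surj (C a b'')" using row_injective_surj[OF assms False] b by blast
    then show ?thesis by auto
  qed
  ultimately show thesis using that by blast
qed

text \<open>At setting 1 the vector \<open>v\<close> suits every choice of the other party, so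
  \<open>l\<close> is free to be chosen such that the contractions at setting 2 are onto.\<close>

lemma common_vector_row:
  fixes A B :: "2 \<Rightarrow> 2 \<Rightarrow> 'k^2"
  assumes B: "\<And>y. det2 (B y 1) (B y 2) \<noteq> 0"
    and inj: "\<And>x. row_injective (A x (k x))"
  shows "\<exists>l v. v \<noteq> 0 \<and> (\<forall>x y. v \<in> range (C (A x (k x)) (B y (l y))))"
proof -
  obtain v where v: "v \<noteq> 0" "\<And>b. b \<noteq> 0 \<Longrightarrow> v \<in> range (C (A 1 (k 1)) b)"
    using row_injective_common[OF inj] by metis
  have "\<exists>l. surj (C (A 2 (k 2)) (B y l))" for y
    using row_injective_surj[OF inj B] by blast
  then obtain l where l: "\<And>y. surj (C (A 2 (k 2)) (B y (l y)))" by metis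
  have "B y (l y) \<noteq> 0" for y
    using B[of y] exhaust_2[of "l y"] by (auto simp: det2_def)
  with v l show ?thesis
    by (intro exI[of _ l] exI[of _ v]) (auto simp: forall_2)
qed

section \<open>Vectors common to the ranges of all four pairs of settings\<close>

lemma expand_left:
  assumes "det2 a1 a2 \<noteq> 0"
  shows "C a b c = (det2 a a2 / det2 a1 a2) *s C a1 b c + (det2 a1 a / det2 a1 a2) *s C a2 b c"
  by (subst det2_expand[OF assms, of a]) (rule lin_left)

lemma expand_mid:
  assumes "det2 b1 b2 \<noteq> 0"
  shows "C a b c = (det2 b b2 / det2 b1 b2) *s C a b1 c + (det2 b1 b / det2 b1 b2) *s C a b2 c"
  by (subst det2_expand[OF assms, of b]) (rule lin_mid)

definition common_vector :: "(2 \<Rightarrow> 2 \<Rightarrow> 'k^2) \<Rightarrow> (2 \<Rightarrow> 2 \<Rightarrow> 'k^2) \<Rightarrow> bool" where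
  "common_vector A B \<longleftrightarrow>
     (\<exists>k l v. v \<noteq> 0 \<and> (\<forall>x y. v \<in> range (C (A x (k x)) (B y (l y)))))"

lemma choose_coordinate:
  fixes A :: "2 \<Rightarrow> 2 \<Rightarrow> 'k^2"
  assumes "\<And>x. det2 (A x 1) (A x 2) \<noteq> 0" "a \<noteq> 0"
  obtains k where "\<And>x. det2 (A x (k x)) a \<noteq> 0"
proof -
  have "\<exists>k. det2 (A x k) a \<noteq> 0" for x
    using det2_nonzero_coordinate[OF assms(2) assms(1)[of x]] by blast
  then show thesis using that by metis
qed

text \<open>The hypotheses say that \<open>c\<close> represents a fully product vector.\<close>

lemma common_vector_product:
  assumes A: "\<And>x. det2 (A x 1) (A x 2) \<noteq> 0" and B: "\<And>y. det2 (B y 1) (B y 2) \<noteq> 0"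
    and "a \<noteq> 0" "b \<noteq> 0" "c \<noteq> 0"
    and a: "\<And>b'. C a b' c = 0" and b: "\<And>a'. C a' b c = 0"
  shows "common_vector A B"
proof -
  obtain k l where k: "\<And>x. det2 (A x (k x)) a \<noteq> 0" and l: "\<And>y. det2 (B y (l y)) b \<noteq> 0"
    using choose_coordinate[of A, OF A \<open>a \<noteq> 0\<close>] choose_coordinate[of B, OF B \<open>b \<noteq> 0\<close>] by metis
  obtain a1 b1 where a1: "det2 a1 a \<noteq> 0" and b1: "det2 b1 b \<noteq> 0"
    using det2_complement \<open>a \<noteq> 0\<close> \<open>b \<noteq> 0\<close> by (metis det2_swap neg_equal_0_iff_equal)
  \<comment> \<open>In the bases \<open>a1\<close>, \<open>a\<close> and \<open>b1\<close>,
    \<open>b\<close> the terms containing \<open>a\<close> or \<open>b\<close> vanish. Every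
    contraction of \<open>c\<close> is therefore a multiple of one vector, with nonzero factor as
    soon as \<open>a'\<close> and \<open>b'\<close> are transverse to \<open>a\<close> and
    \<open>b\<close>.\<close>
  have eq: "C a' b' c = (det2 a' a / det2 a1 a * (det2 b' b / det2 b1 b)) *s C a1 b1 c" for a' b'
    by (subst expand_left[OF a1], subst expand_mid[OF b1]) (simp add: a b)
  have "C a1 b1 c \<noteq> 0"
  proof
    assume "C a1 b1 c = 0"
    then have "C a' b' c = 0" for a' b' by (subst eq) simp
    then show False using nondegenerate \<open>c \<noteq> 0\<close> by blast
  qed
  moreover have "C a1 b1 c \<in> range (C (A x (k x)) (B y (l y)))" for x y
  proof -
    have "C (A x (k x)) (B y (l y)) c \<in> range (C (A x (k x)) (B y (l y)))" by blast
    then show ?thesis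
      by (subst (asm) (1) eq) (subst (asm) range_scale_iff, use k l a1 b1 in auto)
  qed
  ultimately show ?thesis unfolding common_vector_def by blast
qed

text \<open>Here the first party can choose vectors parallel to \<open>a\<close> at both settings.
  Contracting \<open>c\<close> with \<open>a\<close> and a variable \<open>b\<close> gives a
  multiple of \<open>C a b1 c\<close>, which vanishes only for \<open>b\<close> parallel to
  \<open>b2\<close>; the second party avoids that direction.\<close>

lemma common_vector_shared_row:
  assumes B: "\<And>y. det2 (B y 1) (B y 2) \<noteq> 0" and "det2 b1 b2 \<noteq> 0"
    and ne: "\<And>x. A x (k x) \<noteq> 0" and par: "\<And>x. det2 a (A x (k x)) = 0" and "a \<noteq> 0"
    and c: "C a b2 c = 0" "C a b1 c \<noteq> 0"
  shows "common_vector A B"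
proof -
  have "b2 \<noteq> 0" using assms(2) by (auto simp: det2_def)
  then obtain l where l: "\<And>y. det2 (B y (l y)) b2 \<noteq> 0" using choose_coordinate[of B, OF B] by metis
  obtain t where t: "\<And>x. A x (k x) = t x *s a"
    using det2_eq_0_imp_scale[OF par \<open>a \<noteq> 0\<close>] by metis
  have t0: "t x \<noteq> 0" for x using ne[of x] t[of x] by auto
  have "C a b1 c \<in> range (C (A x (k x)) (B y (l y)))" for x y
  proof -
    have "C (A x (k x)) (B y (l y)) c = (t x * (det2 (B y (l y)) b2 / det2 b1 b2)) *s C a b1 c"
      by (subst expand_mid[OF assms(2)]) (simp add: t scale_left c mult.commute)
    then have "\<dots> \<in> range (C (A x (k x)) (B y (l y)))" by (metis rangeI)
    then show ?thesis
      by (subst (asm) range_scale_iff) (use t0[of x] l[of y] assms(2) in auto)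
  qed
  then show ?thesis using c unfolding common_vector_def by blast
qed

lemma two_settings:
  fixes x0 x1 :: 2
  assumes "x0 \<noteq> x1"
  shows "x = x0 \<or> x = x1"
  using assms exhaust_2[of x] exhaust_2[of x0] exhaust_2[of x1] by auto

text \<open>The target is \<open>?p\<close>, which is also parallel to the contraction of
  \<open>d\<close>. Since \<open>c\<close> is killed by \<open>A x0 2\<close>, changing the first
  party's vector only rescales contractions of \<open>c\<close>; likewise for \<open>d\<close> and
  the second party. This settles every pair involving \<open>x0\<close> or \<open>y0\<close>, for
  any choice at \<open>x1\<close> and \<open>y1\<close>, and leaves only the pair \<open>x1\<close>,
  \<open>y1\<close>.\<close>

lemma common_vector_generic:
  assumes A: "\<And>x. det2 (A x 1) (A x 2) \<noteq> 0" and B: "\<And>y. det2 (B y 1) (B y 2) \<noteq> 0"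
    and "x0 \<noteq> x1" "y0 \<noteq> y1"
    and c: "\<And>b. C (A x0 2) b c = 0" "C (A x0 1) (B y0 1) c \<noteq> 0"
    and d: "\<And>a. C a (B y0 2) d = 0" "C (A x0 1) (B y0 1) d \<noteq> 0"
    and par: "det2 (C (A x0 1) (B y0 1) c) (C (A x0 1) (B y0 1) d) = 0"
    and indA: "\<And>k. det2 (A x1 k) (A x0 2) \<noteq> 0" and indB: "\<And>l. det2 (B y1 l) (B y0 2) \<noteq> 0"
  shows "common_vector A B"
proof -
  let ?p = "C (A x0 1) (B y0 1) c"
  have c_eq: "C a b c = (det2 a (A x0 2) / det2 (A x0 1) (A x0 2)) *s C (A x0 1) b c" for a b
    by (subst expand_left[OF A[of x0]]) (simp add: c)
  have d_eq: "C a b d = (det2 b (B y0 2) / det2 (B y0 1) (B y0 2)) *s C a (B y0 1) d" for a b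
    by (subst expand_mid[OF B[of y0]]) (simp add: d)
  have mem_c: "C (A x0 1) b c \<in> range (C (A x1 k) b)" for k b
  proof -
    have "C (A x1 k) b c \<in> range (C (A x1 k) b)" by blast
    then show ?thesis 
      by (subst (asm) (1) c_eq, subst (asm) range_scale_iff) (use indA[of k] A[of x0] in auto)
  qed
  have mem_d: "C a (B y0 1) d \<in> range (C a (B y1 l))" for a l
  proof -
    have "C a (B y1 l) d \<in> range (C a (B y1 l))" by blast
    then show ?thesis 
      by (subst (asm) (1) d_eq, subst (asm) range_scale_iff) (use indB[of l] B[of y0] in auto)
  qed
  have "\<exists>k l. ?p \<in> range (C (A x1 k) (B y1 l))"
  proof (rule ccontr)
    assume none: "\<not> ?thesis"
    \<comment> \<open>If \<open>u = C (A x1 k) (B y0 1) d\<close> were nonzero, it would span the range of \<open>C (A x1 k) (B y1 l)\<close>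
      for both \<open>l\<close>, and combining the two values of \<open>l\<close> would put \<open>?p\<close> on that line.\<close>
    have zero: "C (A x1 k) (B y0 1) d = 0" for k
    proof (rule ccontr)
      let ?u = "C (A x1 k) (B y0 1) d"
      assume u: "?u \<noteq> 0"
      have "det2 ?u (C (A x1 k) (B y1 l) c) = 0" for l
        using independent_in_range_surj[OF mem_d rangeI] none by blast
      then have "det2 ?u (C (A x1 k) (B y0 1) c) = 0"
        by (subst expand_mid[OF B[of y1]]) (simp add: det2_def algebra_simps)
      then obtain t where "C (A x1 k) (B y0 1) c = t *s ?u" 
        using det2_eq_0_imp_scale u by blast
      moreover have "t *s ?u \<in> range (C (A x1 k) (B y1 1))"
        using range_combination[OF mem_d mem_d, where t = 0] by simp
      ultimately have "C (A x1 k) (B y0 1) c \<in> range (C (A x1 k) (B y1 1))" by simp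
      then have "?p \<in> range (C (A x1 k) (B y1 1))"
        by (subst (asm) (1) c_eq, subst (asm) range_scale_iff) (use indA[of k] A[of x0] in auto)
      then show False using none by blast
    qed
    have "C (A x0 1) (B y0 1) d = 0"
      by (subst expand_left[OF A[of x1]]) (simp add: zero)
    then show False using d by simp
  qed
  then obtain k l where kl: "?p \<in> range (C (A x1 k) (B y1 l))" by blast
  obtain t where t: "C (A x0 1) (B y0 1) d = t *s ?p" 
    using det2_eq_0_imp_scale[OF par] c by blast
  with d(2) have "t \<noteq> 0" by auto
  with mem_d[of "A x0 1" l] have "?p \<in> range (C (A x0 1) (B y1 l))"
    unfolding t by (simp add: range_scale_iff)
  with kl mem_c[of "B y0 1" k] 
  have "?p \<in> range (C (A x (if x = x0 then 1 else k)) (B y (if y = y0 then 1 else l)))" for x y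
    using two_settings[OF \<open>x0 \<noteq> x1\<close>, of x] two_settings[OF \<open>y0 \<noteq> y1\<close>, of y] 
    by auto
  then show ?thesis using c(2) unfolding common_vector_def 
    by (intro exI[of _ "\<lambda>x. if x = x0 then 1 else k"]
        exI[of _ "\<lambda>y. if y = y0 then 1 else l"] exI[of _ ?p]) simp
qed

lemma dependent_four:
  fixes w :: "4 \<Rightarrow> 'k^3"
  obtains s :: "'k^4" where "s \<noteq> 0" "s$1 *s w 1 + s$2 *s w 2 + (s$3 *s w 3 + s$4 *s w 4) = 0"
proof -
  define M :: "'k^4^3" where "M = (\<chi> i j. w j $ i)"
  obtain s where "s \<noteq> 0" "M *v s = 0" using nontrivial_kernel[of M] by auto
  moreover have "M *v s = s$1 *s w 1 + s$2 *s w 2 + (s$3 *s w 3 + s$4 *s w 4)"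
    by (simp add: vec_eq_iff M_def matrix_vector_mult_def sum_4 mult.commute add.assoc)
  ultimately show thesis using that by simp
qed

text \<open>The vectors \<open>c 1\<close>, \<open>c 2\<close>, \<open>d 1\<close>,
  \<open>d 2\<close> live in a three-dimensional space, and their linear relation makes
  \<open>?p\<close> and \<open>?q\<close> parallel unless one of the four is a product vector. A
  coincidence of directions between settings is treated by \<open>common_vector_shared_row\<close>,
  all else by \<open>common_vector_generic\<close>.\<close>

lemma common_vector_degenerate:
  assumes A: "\<And>x. det2 (A x 1) (A x 2) \<noteq> 0" and B: "\<And>y. det2 (B y 1) (B y 2) \<noteq> 0"
    and rows: "\<And>k. \<exists>c. c \<noteq> 0 \<and> (\<forall>b. C (A x0 k) b c = 0)"
    and cols: "\<And>l. \<exists>d. d \<noteq> 0 \<and> (\<forall>a. C a (B y0 l) d = 0)"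
  shows "common_vector A B"
proof (rule ccontr)
  assume no: "\<not> common_vector A B"
  have A0: "A x k \<noteq> 0" for x k
    using A[of x] exhaust_2[of k] by (auto simp: det2_def)
  have B0: "B y l \<noteq> 0" for y l
    using B[of y] exhaust_2[of l] by (auto simp: det2_def)
  obtain c where c: "\<And>k. c k \<noteq> 0" "\<And>k b. C (A x0 k) b (c k) = 0" using rows by metis
  obtain d where d: "\<And>l. d l \<noteq> 0" "\<And>l a. C a (B y0 l) (d l) = 0" using cols by metis
  have ind: "det2 (A x k) (A x k') \<noteq> 0" if "k \<noteq> k'" for x k k'
    using A[of x] that exhaust_2[of k] exhaust_2[of k'] by (auto simp: det2_swap[of "A x 2"])
  have indB: "det2 (B y l) (B y l') \<noteq> 0" if "l \<noteq> l'" for y l l'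
    using B[of y] that exhaust_2[of l] exhaust_2[of l'] by (auto simp: det2_swap[of "B y 2"])
  have cn: "C (A x0 k') (B y0 l) (c k) \<noteq> 0" if "k \<noteq> k'" for k k' l
  \<comment> \<open>Otherwise \<open>c k\<close> is annihilated by \<open>A x0 k\<close> on one side
    and by \<open>B y0 l\<close> on the other, that is, it represents a product vector.\<close>
  proof
    assume "C (A x0 k') (B y0 l) (c k) = 0"
    then have "C a (B y0 l) (c k) = 0" for a
      by (subst expand_left[OF ind[OF that, of x0]]) (simp add: c)
    then show False
      using common_vector_product[of A B, OF A B A0 B0 c(1) c(2)] no by blast
  qed
  have dn: "C (A x0 k) (B y0 l') (d l) \<noteq> 0" if "l \<noteq> l'" for k l l'
  proof
    assume "C (A x0 k) (B y0 l') (d l) = 0"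
    then have "C (A x0 k) b (d l) = 0" for b
      by (subst expand_mid[OF indB[OF that, of y0]]) (simp add: d)
    then show False
      using common_vector_product[of A B, OF A B A0 B0 d(1) _ d(2)] no by blast
  qed
  obtain s :: "'k^4" where s: "s \<noteq> 0"
    "s$1 *s c 1 + s$2 *s c 2 + (s$3 *s d 1 + s$4 *s d 2) = 0"
    using dependent_four[of "\<lambda>i. if i = 1 then c 1
      else if i = 2 then c 2 else if i = 3 then d 1 else d 2"]
    by auto
  have rel: "s$1 *s C a b (c 1) + s$2 *s C a b (c 2) + (s$3 *s C a b (d 1) + s$4 *s C a b (d 2)) = 0"
    for a b
    using arg_cong[OF s(2), of "C a b"] by (simp add: add_right scale_right)
  \<comment> \<open>Contracting the relation with \<open>A x0 i\<close> and \<open>B y0 j\<close>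
    kills \<open>c i\<close> and \<open>d j\<close>, so exactly one \<open>c\<close> term and one
    \<open>d\<close> term survive.\<close>
  have r11: "s$2 *s C (A x0 1) (B y0 1) (c 2) + s$4 *s C (A x0 1) (B y0 1) (d 2) = 0"
    using rel[of "A x0 1" "B y0 1"] by (simp add: c d)
  have r12: "s$2 *s C (A x0 1) (B y0 2) (c 2) + s$3 *s C (A x0 1) (B y0 2) (d 1) = 0"
    using rel[of "A x0 1" "B y0 2"] by (simp add: c d)
  have r21: "s$1 *s C (A x0 2) (B y0 1) (c 1) + s$4 *s C (A x0 2) (B y0 1) (d 2) = 0"
    using rel[of "A x0 2" "B y0 1"] by (simp add: c d)
  have "s$2 \<noteq> 0"
  proof
    assume "s$2 = 0"
    then have "s$4 = 0" "s$3 = 0" using r11 r12 dn by auto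
    moreover then have "s$1 = 0" using r21 cn by auto
    ultimately show False using s \<open>s$2 = 0\<close> by (auto simp: vec_eq_iff forall_4)
  qed
  let ?p = "C (A x0 1) (B y0 1) (c 2)" and ?q = "C (A x0 1) (B y0 1) (d 2)"
  have "?p = (- s$4 / s$2) *s ?q"
    using r11 \<open>s$2 \<noteq> 0\<close> by (auto simp: vec_eq_iff field_simps eq_neg_iff_add_eq_0)
  then have par: "det2 ?p ?q = 0" by (simp add: det2_def)
  obtain x1 y1 :: 2 where ne: "x0 \<noteq> x1" "y0 \<noteq> y1"
    by (metis (full_types) exhaust_2 zero_neq_one)
  have "det2 (A x1 k) (A x0 2) \<noteq> 0" for k
  proof
    assume p: "det2 (A x1 k) (A x0 2) = 0"
    \<comment> \<open>Both settings now offer the direction \<open>A x0 2\<close>. The witness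
      \<open>d 2\<close> vanishes against \<open>B y0 2\<close> but, by \<open>dn\<close>, not
      against \<open>B y0 1\<close>.\<close>
    show False
    proof (rule notE[OF no], rule common_vector_shared_row[of B, OF B B[of y0],
          where a = "A x0 2" and k = "\<lambda>x. if x = x0 then 2 else k" and c = "d 2"])
      show "det2 (A x0 2) (A x (if x = x0 then 2 else k)) = 0" for x
        using two_settings[OF ne(1), of x] p by (auto simp: det2_swap[of "A x0 2" "A x1 k"])
    qed (use A0 d dn in auto)
  qed
  moreover have "det2 (B y1 l) (B y0 2) \<noteq> 0" for l
  proof
    assume p: "det2 (B y1 l) (B y0 2) = 0"
    interpret sw: trilinear_block "\<lambda>a b. C b a" by (rule swap)
    have "sw.common_vector B A"
    proof (rule sw.common_vector_shared_row[of A, OF A A[of x0],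
          where a = "B y0 2" and k = "\<lambda>x. if x = y0 then 2 else l" and c = "c 2"])
      show "det2 (B y0 2) (B x (if x = y0 then 2 else l)) = 0" for x
        using two_settings[OF ne(2), of x] p by (auto simp: det2_swap[of "B y0 2" "B y1 l"])
    qed (use B0 c cn in auto)
    then show False using no unfolding sw.common_vector_def common_vector_def by blast
  qed
  ultimately show False
    using common_vector_generic[of A B, OF A B ne c(2) cn d(2) dn par] no by auto
qed

theorem common_vector_exists:
  assumes A: "\<And>x. det2 (A x 1) (A x 2) \<noteq> 0" and B: "\<And>y. det2 (B y 1) (B y 2) \<noteq> 0"
  shows "common_vector A B"
proof -
  interpret sw: trilinear_block "\<lambda>a b. C b a" by (rule swap)
  consider (rows) "\<forall>x. \<exists>k. row_injective (A x k)" | (cols) "\<forall>y. \<exists>l. sw.row_injective (B y l)"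
    | (deg) x0 y0 where "\<And>k. \<not> row_injective (A x0 k)" "\<And>l. \<not> sw.row_injective (B y0 l)"
    by blast
  then show ?thesis
  proof cases
    case rows
    then obtain k where "\<And>x. row_injective (A x (k x))" by metis
    from common_vector_row[of B A k, OF B this] show ?thesis unfolding common_vector_def by blast
  next
    case cols
    then obtain l where "\<And>y. sw.row_injective (B y (l y))" by metis
    from sw.common_vector_row[of A B l, OF A this] show ?thesis unfolding common_vector_def by blast
  next
    case deg
    then show ?thesis
      using common_vector_degenerate[of A B, OF A B]
      unfolding row_injective_def sw.row_injective_def by metis
  qed
qed

end

section \<open>Positive semidefinite forms and qubit POVMs\<close>

definition form :: "complex^'n^'n \<Rightarrow> complex^'n \<Rightarrow> complex^'n \<Rightarrow> complex" where
  "form A u v = (\<Sum>i\<in>UNIV. \<Sum>j\<in>UNIV. cnj (u$i) * A$i$j * v$j)"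

definition outer :: "complex^'n \<Rightarrow> complex^'n^'n" where
  "outer e = (\<chi> i j. e$i * cnj (e$j))"

definition vcnj :: "complex^'n \<Rightarrow> complex^'n" where
  "vcnj u = (\<chi> i. cnj (u$i))"

lemma psd_form: "psd A \<longleftrightarrow> (\<forall>v. Im (form A v v) = 0 \<and> Re (form A v v) \<ge> 0)"
  by (simp add: psd_def form_def)

lemma form_add: "form (A + B) u v = form A u v + form B u v"
  by (simp add: form_def algebra_simps sum.distrib)

lemma form_diff: "form (A - B) u v = form A u v - form B u v"
  by (simp add: form_def algebra_simps sum_subtractf)

lemma form_scaleR: "form (r *\<^sub>R A) u v = r * form A u v"
  by (simp add: form_def sum_distrib_left scaleR_conv_of_real[where 'a = complex] mult_ac)

lemma form_add_left: "form A (u + u') v = form A u v + form A u' v"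
  by (simp add: form_def algebra_simps sum.distrib)

lemma form_add_right: "form A u (v + v') = form A u v + form A u v'"
  by (simp add: form_def algebra_simps sum.distrib)

lemma form_scale_left: "form A (s *s u) v = cnj s * form A u v"
  by (simp add: form_def sum_distrib_left mult_ac)

lemma form_scale_right: "form A u (s *s v) = s * form A u v"
  by (simp add: form_def sum_distrib_left mult_ac)

lemmas form_linear = form_add_left form_add_right form_scale_left form_scale_right

text \<open>Polarization: reality of the form at \<open>u + v\<close> controls the imaginary parts,
  and at \<open>u + \<i> *s v\<close> the real parts.\<close>

lemma psd_hermitian:
  assumes "psd A"
  shows "form A v u = cnj (form A u v)"
proof -
  have real: "Im (form A w w) = 0" for w using assms by (simp add: psd_form)
  have "Im (form A u v + form A v u) = 0"
    using real[of "u + v"] real[of u] real[of v] by (simp add: form_linear)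
  moreover have "Re (form A u v - form A v u) = 0"
    using real[of "u + \<i> *s v"] real[of u] real[of v] by (simp add: form_linear)
  ultimately show ?thesis by (simp add: complex_eq_iff)
qed

lemma form_axis: "form A (axis i 1) (axis j 1) = A$i$j"
proof -
  have "form A (axis i 1) (axis j 1) =
      (\<Sum>k\<in>UNIV. \<Sum>l\<in>UNIV. if k = i then (if l = j then A$k$l else 0) else 0)"
    unfolding form_def by (intro sum.cong refl) (auto simp: axis_def)
  also have "\<dots> = A$i$j" 
    by (subst sum.swap) simp
  finally show ?thesis .
qed

lemma psd_hermitian_entries: "psd A \<Longrightarrow> A$j$i = cnj (A$i$j)"
  using psd_hermitian[of A "axis j 1" "axis i 1"] by (simp add: form_axis)

text \<open>With \<open>w = A *v z\<close> this says that \<open>A\<close> dominates a positive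
  multiple of \<open>outer w\<close>, so such a multiple of any vector in the range can be
  subtracted.\<close>

lemma psd_ge_range:
  assumes "psd A"
  obtains \<delta> :: real where "\<delta> > 0" "\<And>y. Re (form A y y) \<ge> \<delta> * (cmod (form A y z))\<^sup>2"
proof
  define Z where "Z = Re (form A z z)"
  have Z: "Z \<ge> 0" "form A z z = of_real Z"
    using assms by (auto simp: psd_form Z_def complex_eq_iff)
  \<comment> \<open>The summand 1 gives \<open>\<delta> * Z \<le> 1\<close> and keeps
    \<open>\<delta>\<close> positive when \<open>Z\<close> is zero.\<close>
  define \<delta> where "\<delta> = 1 / (1 + Z)"
  show d: "\<delta> > 0" using Z by (simp add: \<delta>_def)
  fix y
  define h where "h = form A y z"
  have zy: "form A z y = cnj h" unfolding h_def by (rule psd_hermitian[OF assms])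
  \<comment> \<open>Cauchy--Schwarz, by expanding the form at \<open>y - \<delta> cnj h z\<close>.\<close>
  have expand: "form A (y + s *s z) (y + s *s z)
      = form A y y + s * h + (cnj s * cnj h + cnj s * s * of_real Z)" for s
    by (simp add: form_linear zy Z(2) algebra_simps flip: h_def)
  have "0 \<le> Re (form A (y + (- \<delta> * cnj h) *s z) (y + (- \<delta> * cnj h) *s z))"
    using assms by (simp add: psd_form)
  also have "\<dots> = Re (form A y y) - 2 * \<delta> * (cmod h)\<^sup>2 + \<delta>\<^sup>2 * (cmod h)\<^sup>2 * Z"
    unfolding expand by (simp add: cmod_def power2_eq_square algebra_simps)
  also have "\<delta>\<^sup>2 * (cmod h)\<^sup>2 * Z = \<delta> * (cmod h)\<^sup>2 * (\<delta> * Z)" by (simp add: power2_eq_square)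
  also have "\<dots> \<le> \<delta> * (cmod h)\<^sup>2"
    using d Z by (intro mult_left_le) (auto simp: \<delta>_def)
  finally show "Re (form A y y) \<ge> \<delta> * (cmod (form A y z))\<^sup>2"
    by (simp add: h_def)
qed

lemma form_outer: "form (outer e) u u = of_real ((cmod (\<Sum>i\<in>UNIV. cnj (u$i) * e$i))\<^sup>2)"
proof -
  have "form (outer e) u u = (\<Sum>i\<in>UNIV. cnj (u$i) * e$i) * (\<Sum>j\<in>UNIV. cnj (e$j) * u$j)"
    by (simp add: form_def outer_def sum_product mult_ac)
  also have "(\<Sum>j\<in>UNIV. cnj (e$j) * u$j) = cnj (\<Sum>i\<in>UNIV. cnj (u$i) * e$i)"
    by (simp add: mult_ac)
  finally show ?thesis by (simp only: complex_norm_square)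
qed

lemma psd_outer: "psd (outer e)"
  by (simp add: psd_form form_outer)

lemma psd_scaleR: "psd A \<Longrightarrow> r \<ge> 0 \<Longrightarrow> psd (r *\<^sub>R A)"
  by (simp add: psd_form form_scaleR)

lemma density_outer:
  fixes v :: "complex^'n"
  assumes "v \<noteq> 0"
  defines "r \<equiv> (\<Sum>i\<in>UNIV. (cmod (v$i))\<^sup>2)"
  shows "density ((1 / r) *\<^sub>R outer v)" "r > 0"
proof -
  obtain i where "v$i \<noteq> 0" using assms(1) by (auto simp: vec_eq_iff)
  then show "r > 0" unfolding r_def by (intro sum_pos2[of _ i]) auto
  moreover have "trace (outer v) = of_real r"
    by (simp add: trace_def outer_def r_def complex_norm_square del: of_real_power)
  then have "trace ((1 / r) *\<^sub>R outer v) = (1 / r) *\<^sub>R complex_of_real r"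
    by (simp add: trace_def flip: scaleR_sum_right)
  ultimately show "density ((1 / r) *\<^sub>R outer v)"
    by (simp add: density_def psd_scaleR psd_outer scaleR_conv_of_real[where 'a = complex])
qed

section \<open>Spectral decomposition of qubit effects\<close>

definition perp :: "complex^2 \<Rightarrow> complex^2" where
  "perp e = vector [- cnj (e$2), cnj (e$1)]"

lemma qubit_psd_eigenvector:
  fixes H :: "complex^2^2"
  assumes "psd H"
  obtains g and l :: real where "g \<noteq> 0" "H *v g = of_real l *s g"
proof -
  define a where "a = Re (H$1$1)"
  define d where "d = Re (H$2$2)"
  define b where "b = H$1$2"
  have herm: "H$i$j = cnj (H$j$i)" for i j using psd_hermitian_entries[OF assms] .
  have H: "H$1$1 = of_real a" "H$2$2 = of_real d" "H$1$2 = b" "H$2$1 = cnj b"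
    using herm[of 1 1] herm[of 2 2] herm[of 2 1] by (auto simp: a_def d_def b_def complex_eq_iff)
  show thesis
  proof (cases "b = 0")
    case True
    show thesis
      by (rule that[of "axis 1 1" a])
        (auto simp: axis_eq_0_iff vec_eq_iff forall_2 matrix_vector_mult_def sum_2 H True axis_def)
  next
    case False
    \<comment> \<open>The quadratic formula: \<open>l\<close> is the larger root of the
      characteristic polynomial, and the first row of the eigenvalue equation suggests the vector
      \<open>[b, l - a]\<close>.\<close>
    define s where "s = sqrt (((a - d) / 2)\<^sup>2 + (cmod b)\<^sup>2)"
    define l where "l = (a + d) / 2 + s"
    have "s\<^sup>2 = ((a - d) / 2)\<^sup>2 + (cmod b)\<^sup>2" by (simp add: s_def)
    moreover have "(l - d) * (l - a) = s\<^sup>2 - ((a - d) / 2)\<^sup>2"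
      unfolding l_def by (simp add: power2_eq_square field_simps)
    ultimately have "(l - d) * (l - a) = (cmod b)\<^sup>2" by simp
    then have ch: "complex_of_real (l - d) * of_real (l - a) = b * cnj b"
      by (metis complex_norm_square of_real_mult)
    show thesis
      by (rule that[of "vector [b, of_real (l - a)]" l])
        (use False ch in \<open>auto simp: vec_eq_iff forall_2 matrix_vector_mult_def sum_2 H algebra_simps\<close>)
  qed
qed

lemma qubit_spectral:
  fixes H :: "complex^2^2"
  assumes "psd H"
  obtains e and l m :: real where "(cmod (e$1))\<^sup>2 + (cmod (e$2))\<^sup>2 = 1"
    "H = l *\<^sub>R outer e + m *\<^sub>R outer (perp e)"
proof -
  obtain g l where g: "g \<noteq> 0" "H *v g = of_real l *s g" using qubit_psd_eigenvector[OF assms] .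
  define r where "r = sqrt ((cmod (g$1))\<^sup>2 + (cmod (g$2))\<^sup>2)"
  have r: "r > 0"
    using g(1) by (auto simp: r_def vec_eq_iff forall_2 intro: add_pos_nonneg add_nonneg_pos)
  define e where "e = of_real (1 / r) *s g"
  define x where "x = e$1"
  define y where "y = e$2"
  have unit: "(cmod x)\<^sup>2 + (cmod y)\<^sup>2 = 1"
  proof -
    have "(cmod x)\<^sup>2 + (cmod y)\<^sup>2 = ((cmod (g$1))\<^sup>2 + (cmod (g$2))\<^sup>2) / r\<^sup>2"
      by (simp add: x_def y_def e_def norm_mult norm_divide power_divide add_divide_distrib)
    also have "(cmod (g$1))\<^sup>2 + (cmod (g$2))\<^sup>2 = r\<^sup>2" by (simp add: r_def)
    finally show ?thesis using r by simp
  qed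
  then have u: "x * cnj x + y * cnj y = 1"
    by (metis complex_norm_square of_real_add of_real_1)
  have "H *v e = of_real l *s e"
    unfolding e_def by (simp add: vector_scalar_commute g(2) vec_eq_iff)
  then have "(H *v e)$1 = of_real l * x" "(H *v e)$2 = of_real l * y" by (auto simp: x_def y_def)
  then have e1: "H$1$1 * x + H$1$2 * y = of_real l * x"
    and e2: "H$2$1 * x + H$2$2 * y = of_real l * y"
    by (simp_all add: matrix_vector_mult_def sum_2 x_def y_def)
  have herm: "H$i$j = cnj (H$j$i)" for i j using psd_hermitian_entries[OF assms] .
  define a where "a = Re (H$1$1)"
  define d where "d = Re (H$2$2)"
  define b where "b = H$1$2"
  have H: "H$1$1 = of_real a" "H$2$2 = of_real d" "H$1$2 = b" "H$2$1 = cnj b"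
    using herm[of 1 1] herm[of 2 2] herm[of 2 1] by (auto simp: a_def d_def b_def complex_eq_iff)
  \<comment> \<open>The method \<open>algebra\<close> treats \<open>x\<close> and
    \<open>cnj x\<close> as unrelated unknowns, so the conjugated equations are supplied
    explicitly.\<close>
  have e2': "b * cnj x + of_real d * cnj y = of_real l * cnj y"
    using arg_cong[OF e2, of cnj] by (simp add: H)
  have e1': "cnj b * cnj y + of_real a * cnj x = of_real l * cnj x"
    using arg_cong[OF e1, of cnj] by (simp add: H add.commute)
  note e = e1[unfolded H] e2[unfolded H] e2' e1' u
  \<comment> \<open>The second eigenvalue is the trace minus the first.\<close>
  define m where "m = a + d - l"
  have h11: "of_real a = of_real l * (x * cnj x) + of_real m * (y * cnj y)"
    using e unfolding m_def of_real_add of_real_diff by algebra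
  have h22: "of_real d = of_real l * (y * cnj y) + of_real m * (x * cnj x)"
    using e unfolding m_def of_real_add of_real_diff by algebra
  have h12: "b = of_real l * (x * cnj y) - of_real m * (x * cnj y)"
    using e unfolding m_def of_real_add of_real_diff by algebra
  have h21: "cnj b = of_real l * (y * cnj x) - of_real m * (y * cnj x)"
    using arg_cong[OF h12, of cnj] by (simp add: mult_ac)
  have "H = l *\<^sub>R outer e + m *\<^sub>R outer (perp e)"
    unfolding vec_eq_iff forall_2
    by (simp add: H h11 h22 h12 h21 outer_def perp_def
        scaleR_conv_of_real[where 'a = complex] flip: x_def y_def)
  with unit show thesis using that unfolding x_def y_def by blast
qed

lemma outer_complete:
  assumes "(cmod (e$1))\<^sup>2 + (cmod (e$2))\<^sup>2 = 1"
  shows "outer e + outer (perp e) = mat 1"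
proof -
  have "e$1 * cnj (e$1) + e$2 * cnj (e$2) = 1"
    using assms by (metis complex_norm_square of_real_add of_real_1)
  then show ?thesis
    by (simp add: vec_eq_iff forall_2 outer_def perp_def mat_def mult.commute add.commute)
qed

lemma psd_combination_nonneg:
  assumes "(cmod (e$1))\<^sup>2 + (cmod (e$2))\<^sup>2 = 1" "psd (l *\<^sub>R outer e + m *\<^sub>R outer (perp e))"
  shows "l \<ge> 0" "m \<ge> 0"
proof -
  have u: "e$1 * cnj (e$1) + e$2 * cnj (e$2) = 1"
    using assms by (metis complex_norm_square of_real_add of_real_1)
  have "form (l *\<^sub>R outer e + m *\<^sub>R outer (perp e)) e e = of_real l"
    using u by (simp add: form_add form_scaleR form_outer sum_2 perp_def mult.commute)
  then show "l \<ge> 0" using assms(2) by (metis psd_form Re_complex_of_real)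
  have "form (l *\<^sub>R outer e + m *\<^sub>R outer (perp e)) (perp e) (perp e) = of_real m"
    using u by (simp add: form_add form_scaleR form_outer sum_2 perp_def mult.commute add.commute)
  then show "m \<ge> 0" using assms(2) by (metis psd_form Re_complex_of_real)
qed

text \<open>Both effects share the eigenvectors \<open>e k\<close>, with eigenvalues
  \<open>m a k\<close>. Only independence of the eigenvectors is recorded, as this is what the
  contraction argument consumes; the positivity clause provides an outcome that sees a given
  eigenvector.\<close>

definition diagonalizes ::
  "(2 \<Rightarrow> complex^2^2) \<Rightarrow> (2 \<Rightarrow> complex^2) \<Rightarrow> (2 \<Rightarrow> 2 \<Rightarrow> real) \<Rightarrow> bool" where
  "diagonalizes P e m \<longleftrightarrow> det2 (e 1) (e 2) \<noteq> 0 \<and> (\<forall>a k. m a k \<ge> 0) \<and> (\<forall>k. \<exists>a. m a k > 0) \<and>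
    (\<forall>a. P a = (\<Sum>k\<in>UNIV. m a k *\<^sub>R outer (e k)))"

lemma qubit_povm_diagonalizable:
  assumes "povm P"
  shows "\<exists>e m. diagonalizes P e m"
proof -
  have psd: "psd (P a)" for a using assms by (simp add: povm_def)
  have sum: "P 1 + P 2 = mat 1" using assms by (simp add: povm_def sum_2)
  obtain e l1 l2 where e: "(cmod (e$1))\<^sup>2 + (cmod (e$2))\<^sup>2 = 1"
    and P1: "P 1 = l1 *\<^sub>R outer e + l2 *\<^sub>R outer (perp e)"
    using qubit_spectral[OF psd] .
  \<comment> \<open>The second effect is the identity minus the first, hence diagonal in the same
    basis.\<close>
  have P2: "P 2 = (1 - l1) *\<^sub>R outer e + (1 - l2) *\<^sub>R outer (perp e)"
    using sum unfolding P1 outer_complete[OF e, symmetric] 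
    by (simp add: algebra_simps eq_diff_eq)
  have nn: "l1 \<ge> 0" "l2 \<ge> 0" "1 - l1 \<ge> 0" "1 - l2 \<ge> 0"
    using psd_combination_nonneg[OF e] psd P1 P2 by metis+
  define f where "f = (\<lambda>k :: 2. if k = 1 then e else perp e)"
  define m where "m = (\<lambda>(a :: 2) (k :: 2). let l = if k = 1 then l1 else l2 in if a = 1 then l else 1 - l)"
  have "e$1 * cnj (e$1) + e$2 * cnj (e$2) = 1"
    using e by (metis complex_norm_square of_real_add of_real_1)
  then have "det2 (f 1) (f 2) \<noteq> 0" by (simp add: f_def det2_def perp_def)
  moreover have "\<forall>a k. m a k \<ge> 0" using nn by (simp add: m_def)
  moreover have "\<exists>a. m a k > 0" for k
  proof (cases "m 1 k > 0")
    case False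
    then have "m 2 k > 0" by (auto simp: m_def Let_def split: if_splits)
    then show ?thesis by blast
  qed blast
  moreover have "\<forall>a. P a = (\<Sum>k\<in>UNIV. m a k *\<^sub>R outer (f k))"
    by (simp add: forall_2 sum_2 P1 P2 m_def f_def)
  ultimately have "diagonalizes P f m" unfolding diagonalizes_def by blast
  then show ?thesis by blast
qed

section \<open>Steered assemblages\<close>

definition steer :: "complex^(2\<times>2\<times>2)^(2\<times>2\<times>2) \<Rightarrow> complex^2^2 \<Rightarrow> complex^2^2 \<Rightarrow> complex^2^2" where
  "steer \<rho> M N = ptrace_AB (kron3_id M N ** \<rho>)"

definition tens :: "complex^2 \<Rightarrow> complex^2 \<Rightarrow> complex^2 \<Rightarrow> complex^(2\<times>2\<times>2)" where
  "tens e h u = (\<chi> r. case r of (i, j, k) \<Rightarrow> e$i * h$j * u$k)"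

lemma sum_triple: "(\<Sum>r\<in>UNIV. f r) = (\<Sum>i\<in>UNIV. \<Sum>j\<in>UNIV. \<Sum>k\<in>UNIV. f (i, j, k))"
  for f :: "'a::finite \<times> 'b::finite \<times> 'c::finite \<Rightarrow> 'd::comm_monoid_add"
  by (simp add: sum.cartesian_product flip: UNIV_Times_UNIV) 

lemma steer_nth:
  "steer \<rho> M N $ k $ k' =
    (\<Sum>i\<in>UNIV. \<Sum>j\<in>UNIV. \<Sum>i'\<in>UNIV. \<Sum>j'\<in>UNIV. M$i$i' * N$j$j' * \<rho>$(i',j',k)$(i,j,k'))"
proof -
  have "(\<Sum>k''\<in>UNIV. M$i$i' * N$j$j' * (if k = k'' then 1 else 0) * \<rho>$(i',j',k'')$(i,j,k')) =
    M$i$i' * N$j$j' * \<rho>$(i',j',k)$(i,j,k')" for i j i' j'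
    by (subst sum.cong[OF refl, where
          h = "\<lambda>k''. if k = k'' then M$i$i' * N$j$j' * \<rho>$(i',j',k'')$(i,j,k') else 0"])
      auto
  then show ?thesis
    by (simp add: steer_def ptrace_AB_def kron3_id_def matrix_matrix_mult_def sum_triple)
qed

lemma steer_add_left: "steer \<rho> (M + M') N = steer \<rho> M N + steer \<rho> M' N"
  by (simp add: vec_eq_iff steer_nth algebra_simps sum.distrib)

lemma steer_add_right: "steer \<rho> M (N + N') = steer \<rho> M N + steer \<rho> M N'"
  by (simp add: vec_eq_iff steer_nth algebra_simps sum.distrib)

lemma steer_scaleR: "steer \<rho> (r *\<^sub>R M) (s *\<^sub>R N) = (r * s) *\<^sub>R steer \<rho> M N"
  by (simp add: vec_eq_iff steer_nth scaleR_conv_of_real[where 'a = complex] sum_distrib_left mult_ac)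

lemma trace_steer_id: "trace (steer \<rho> (mat 1) (mat 1)) = trace \<rho>"
  by (simp add: trace_def steer_nth sum_triple sum_2 mat_def)

text \<open>For rank-one effects the steered operator is the compression of \<open>\<rho>\<close> to
  \<open>e \<otimes> h\<close>, which reduces positivity questions to the form of
  \<open>\<rho>\<close>.\<close>

lemma form_steer_outer:
  "form (steer \<rho> (outer e) (outer h)) u u = form \<rho> (tens e h u) (tens e h u)"
  by (simp add: form_def steer_nth outer_def tens_def sum_triple sum_2 algebra_simps)

lemma form_steer_sum:
  fixes m n :: "2 \<Rightarrow> real"
  shows "form (steer \<rho> (\<Sum>k\<in>UNIV. m k *\<^sub>R outer (e k)) (\<Sum>l\<in>UNIV. n l *\<^sub>R outer (h l))) u u
    = (\<Sum>k\<in>UNIV. \<Sum>l\<in>UNIV. of_real (m k * n l) * form \<rho> (tens (e k) (h l) u) (tens (e k) (h l) u))"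
  by (simp add: sum_2 steer_add_left steer_add_right steer_scaleR form_add form_scaleR
      form_steer_outer)

lemma psd_steer:
  fixes m n :: "2 \<Rightarrow> real"
  assumes "psd \<rho>" "\<And>k. m k \<ge> 0" "\<And>l. n l \<ge> 0"
  shows "psd (steer \<rho> (\<Sum>k\<in>UNIV. m k *\<^sub>R outer (e k)) (\<Sum>l\<in>UNIV. n l *\<^sub>R outer (h l)))"
  using assms unfolding psd_form form_steer_sum by (auto intro!: sum_nonneg)

text \<open>The rank supplies three independent rows; hermiticity turns them into columns by
  conjugation, which preserves independence.\<close>

lemma psd_rank_columns:
  fixes \<rho> :: "complex^'n^'n"
  assumes "psd \<rho>" "rank \<rho> \<ge> 3"
  obtains \<iota> :: "3 \<Rightarrow> 'n" where "\<And>c :: complex^3. (\<Sum>t\<in>UNIV. c$t *s column (\<iota> t) \<rho>) = 0 \<Longrightarrow> c = 0"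
proof -
  obtain B where B: "B \<subseteq> rows \<rho>" "vec.independent B" "card B = vec.dim (rows \<rho>)"
    using vec.basis_exists[of "rows \<rho>"] by metis
  then have "3 \<le> card B" using assms(2) by (simp add: row_rank_def_gen)
  then obtain B' where B': "B' \<subseteq> B" "card B' = 3" "finite B'" by (rule obtain_subset_with_card_n)
  obtain g :: "3 \<Rightarrow> complex^'n" where g: "bij_betw g UNIV B'"
    using B' finite_same_card_bij[of "UNIV :: 3 set" B'] by auto
  have "g t \<in> rows \<rho>" for t
    using g B(1) B'(1) by (auto simp: bij_betw_def)
  then have "\<exists>i. g t = row i \<rho>" for t by (auto simp: rows_def)
  then have "\<forall>t. \<exists>i. g t = row i \<rho>" by blast
  from choice[OF this] obtain \<iota> where \<iota>: "\<And>t. g t = row (\<iota> t) \<rho>" by blast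
  show thesis
  proof (rule that[of \<iota>])
    fix c :: "complex^3"
    assume z: "(\<Sum>t\<in>UNIV. c$t *s column (\<iota> t) \<rho>) = 0"
    have col: "column (\<iota> t) \<rho> $ j = cnj (g t $ j)" for t j
      by (simp add: \<iota> column_def row_def psd_hermitian_entries[OF assms(1), of j "\<iota> t"])
    have "(\<Sum>t\<in>UNIV. cnj (c$t) *s g t) $ j = cnj ((\<Sum>t\<in>UNIV. c$t *s column (\<iota> t) \<rho>) $ j)" for j
      by (simp add: sum_3 col)
    then have "(\<Sum>t\<in>UNIV. cnj (c$t) *s g t) = 0" using z by (simp add: vec_eq_iff)
    moreover have "(\<Sum>t\<in>UNIV. cnj (c$t) *s g t) = (\<Sum>v\<in>B'. cnj (c $ (inv_into UNIV g v)) *s v)"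
      using sum.reindex_bij_betw[OF g, of "\<lambda>v. cnj (c $ (inv_into UNIV g v)) *s v"] g
      by (simp add: bij_betw_def)
    ultimately have "(\<Sum>v\<in>B'. cnj (c $ (inv_into UNIV g v)) *s v) = 0" by simp
    moreover have "vec.independent B'" using vec.independent_mono[OF B(2) B'(1)] .
    ultimately have "cnj (c $ (inv_into UNIV g v)) = 0" if "v \<in> B'" for v
      using vec.independentD[of B' B' "\<lambda>v. cnj (c $ (inv_into UNIV g v))" v] that B'(3) by simp
    then have "cnj (c $ t) = 0" for t
      using g by (metis UNIV_I bij_betw_apply bij_betw_inv_into_left)
    then show "c = 0" by (simp add: vec_eq_iff)
  qed
qed

section \<open>Splitting off a deterministic part\<close>

lemma LHS_deterministic:
  fixes f g :: "'s \<Rightarrow> 'o::finite" and \<tau> :: "complex^'d^'d"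
  assumes "density \<tau>"
  shows "LHS (\<lambda>a b x y. if a = f x \<and> b = g y then \<tau> else 0)"
  unfolding LHS_def
  by (rule exI[of _ "{0}"], rule exI[of _ "\<lambda>_. 1"], rule exI[of _ "\<lambda>_. \<tau>"],
      rule exI[of _ "\<lambda>_ a x. if a = f x then 1 else 0"],
      rule exI[of _ "\<lambda>_ b y. if b = g y then 1 else 0"]) (use assms in auto)

text \<open>Subtracting the deterministic assemblage \<open>D\<close> changes only the outcomes
  \<open>f x\<close>, \<open>g y\<close>, where \<open>ge\<close> keeps positivity. Each marginal of
  \<open>D\<close> depends on one party's setting alone, so the rescaled remainder \<open>R\<close>
  is again no-signaling.\<close>

lemma not_on_edge:
  fixes S :: "'o::finite \<Rightarrow> 'o \<Rightarrow> 's \<Rightarrow> 's \<Rightarrow> complex^'d^'d"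
  assumes ns: "no_signaling S" and \<tau>: "density \<tau>" and \<epsilon>: "0 < \<epsilon>" "\<epsilon> < 1"
    and ge: "\<And>x y. psd (S (f x) (g y) x y - \<epsilon> *\<^sub>R \<tau>)"
  shows "\<not> on_edge S"
proof
  assume edge: "on_edge S"
  define D where "D = (\<lambda>a b x y. if a = f x \<and> b = g y then \<tau> else 0)"
  define R where "R = (\<lambda>a b x y. (1 / (1 - \<epsilon>)) *\<^sub>R (S a b x y - \<epsilon> *\<^sub>R D a b x y))"
  have D_b: "(\<Sum>b\<in>UNIV. D a b x y) = (if a = f x then \<tau> else 0)" for a x y
    by (simp add: D_def sum.delta)
  have D_a: "(\<Sum>a\<in>UNIV. D a b x y) = (if b = g y then \<tau> else 0)" for b x y
    by (simp add: D_def sum.delta)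
  have R_b: "(\<Sum>b\<in>UNIV. R a b x y) =
      (1 / (1 - \<epsilon>)) *\<^sub>R ((\<Sum>b\<in>UNIV. S a b x y) - \<epsilon> *\<^sub>R (if a = f x then \<tau> else 0))" for a x y
    unfolding R_def scaleR_sum_right[symmetric] sum_subtractf D_b ..
  have R_a: "(\<Sum>a\<in>UNIV. R a b x y) =
      (1 / (1 - \<epsilon>)) *\<^sub>R ((\<Sum>a\<in>UNIV. S a b x y) - \<epsilon> *\<^sub>R (if b = g y then \<tau> else 0))" for b x y
    unfolding R_def scaleR_sum_right[symmetric] sum_subtractf D_a ..
  obtain \<rho> where \<rho>: "trace \<rho> = 1" "\<And>x y. (\<Sum>a\<in>UNIV. \<Sum>b\<in>UNIV. S a b x y) = \<rho>"
    using ns unfolding no_signaling_def by blast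
  have "no_signaling R"
    unfolding no_signaling_def
  proof (intro conjI allI)
    show "psd (R a b x y)" for a b x y
      using ge[of x y] ns \<epsilon> unfolding R_def D_def no_signaling_def by (auto intro!: psd_scaleR)
    show "\<exists>\<rho>. trace \<rho> = 1 \<and> (\<forall>x y. (\<Sum>a\<in>UNIV. \<Sum>b\<in>UNIV. R a b x y) = \<rho>)"
    proof (intro exI conjI allI)
      show "(\<Sum>a\<in>UNIV. \<Sum>b\<in>UNIV. R a b x y) = (1 / (1 - \<epsilon>)) *\<^sub>R (\<rho> - \<epsilon> *\<^sub>R \<tau>)" for x y
        unfolding R_b scaleR_sum_right[symmetric] sum_subtractf \<rho> by (simp add: sum.delta)
      have "trace ((1 / (1 - \<epsilon>)) *\<^sub>R (\<rho> - \<epsilon> *\<^sub>R \<tau>)) =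
          (1 / (1 - \<epsilon>)) *\<^sub>R (trace \<rho> - \<epsilon> *\<^sub>R trace \<tau>)"
        by (simp add: trace_def sum_subtractf flip: scaleR_sum_right)
      also have "\<dots> = 1"
        using \<epsilon> \<rho>(1) \<tau> by (simp add: density_def complex_eq_iff)
      finally show "trace ((1 / (1 - \<epsilon>)) *\<^sub>R (\<rho> - \<epsilon> *\<^sub>R \<tau>)) = 1" .
    qed
    show "(\<Sum>b\<in>UNIV. R a b x y) = (\<Sum>b\<in>UNIV. R a b x y')" for a x y y'
      using ns unfolding R_b no_signaling_def by metis
    show "(\<Sum>a\<in>UNIV. R a b x y) = (\<Sum>a\<in>UNIV. R a b x' y)" for b x x' y
      using ns unfolding R_a no_signaling_def by metis
  qed
  moreover have "S a b x y = \<epsilon> *\<^sub>R D a b x y + (1 - \<epsilon>) *\<^sub>R R a b x y" for a b x y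
    using \<epsilon> by (simp add: R_def)
  moreover have "LHS D" unfolding D_def using LHS_deterministic[OF \<tau>] .
  ultimately have "\<epsilon> = 0" using edge \<epsilon> unfolding on_edge_def by (meson less_imp_le)
  then show False using \<epsilon> by simp
qed

lemma steer_no_signaling:
  fixes M N :: "2 \<Rightarrow> 2 \<Rightarrow> complex^2^2"
  assumes \<rho>: "density \<rho>" and M: "\<And>x. povm (\<lambda>a. M a x)" and N: "\<And>y. povm (\<lambda>b. N b y)"
  shows "no_signaling (\<lambda>a b x y. steer \<rho> (M a x) (N b y))"
proof -
  have sums: "M 1 x + M 2 x = mat 1" "N 1 x + N 2 x = mat 1" for x
    using M[of x] N[of x] by (auto simp: povm_def sum_2)
  have rsum: "(\<Sum>b\<in>UNIV. steer \<rho> A (N b y)) = steer \<rho> A (mat 1)" for A y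
    by (simp add: sum_2 sums flip: steer_add_right)
  have lsum: "(\<Sum>a\<in>UNIV. steer \<rho> (M a x) A) = steer \<rho> (mat 1) A" for A x
    by (simp add: sum_2 sums flip: steer_add_left)
  have "psd (steer \<rho> (M a x) (N b y))" for a b x y
  proof -
    obtain e m h n where "diagonalizes (\<lambda>a. M a x) e m" "diagonalizes (\<lambda>b. N b y) h n"
      using qubit_povm_diagonalizable[OF M[of x]] qubit_povm_diagonalizable[OF N[of y]] by blast
    then show ?thesis using psd_steer[of \<rho> "m a" "n b"] \<rho> by (simp add: density_def diagonalizes_def)
  qed
  moreover have "trace (steer \<rho> (mat 1) (mat 1)) = 1"
    using \<rho> by (simp add: trace_steer_id density_def)
  ultimately show ?thesis
    unfolding no_signaling_def rsum lsum by blast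
qed

text \<open>The equation states that contracting \<open>\<rho> *v z\<close> with the two
  eigenvectors yields \<open>v\<close>, with the same \<open>v\<close> for all four pairs of
  settings.\<close>

lemma steer_common_vector:
  fixes e h :: "2 \<Rightarrow> 2 \<Rightarrow> complex^2"
  assumes "psd \<rho>" "rank \<rho> \<ge> 3"
    and e: "\<And>x. det2 (e x 1) (e x 2) \<noteq> 0" and h: "\<And>y. det2 (h y 1) (h y 2) \<noteq> 0"
  shows "\<exists>k l v. v \<noteq> 0 \<and> (\<forall>x y. \<exists>z. \<forall>u.
    form \<rho> (tens (e x (k x)) (h y (l y)) u) z = (\<Sum>i\<in>UNIV. cnj (u$i) * v$i))"
proof -
  obtain \<iota> :: "3 \<Rightarrow> 2 \<times> 2 \<times> 2" where
    \<iota>: "\<And>c :: complex^3. (\<Sum>t\<in>UNIV. c$t *s column (\<iota> t) \<rho>) = 0 \<Longrightarrow> c = 0"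
    using psd_rank_columns[OF assms(1,2)] by blast
  \<comment> \<open>Applying \<open>\<rho>\<close> to \<open>z c\<close> gives the combination of
    the columns \<open>\<iota> t\<close> with coefficients \<open>c\<close>; these combinations form
    the three-dimensional space \<open>W\<close>, and independence of the columns yields
    nondegeneracy.\<close>
  define z :: "complex^3 \<Rightarrow> complex^(2\<times>2\<times>2)" where "z c = (\<Sum>t\<in>UNIV. c$t *s axis (\<iota> t) 1)" for c
  define C :: "complex^2 \<Rightarrow> complex^2 \<Rightarrow> complex^3 \<Rightarrow> complex^2" where
    "C a b c = (\<chi> k. \<Sum>i\<in>UNIV. \<Sum>j\<in>UNIV. a$i * b$j * (\<rho> *v z c)$(i,j,k))" for a b c
  have z_lin: "z (s *s c + t *s c') = s *s z c + t *s z c'" for s t c c'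
    by (simp add: z_def sum_3 vec_eq_iff algebra_simps)
  interpret trilinear_block C
  proof
    show "C (s *s a + t *s a') b c = s *s C a b c + t *s C a' b c" 
      for s a t a' b c
      by (simp add: C_def vec_eq_iff sum_2 algebra_simps)
    show "C a (s *s b + t *s b') c = s *s C a b c + t *s C a b' c" 
      for s a t b b' c
      by (simp add: C_def vec_eq_iff sum_2 algebra_simps)
    show "C a b (s *s c + t *s c') = s *s C a b c + t *s C a b c'" 
      for s a t b c c'
      by (simp add: C_def vec_eq_iff sum_2 algebra_simps z_lin
          matrix_vector_right_distrib vector_scalar_commute)
    fix c assume 0: "\<And>a b. C a b c = 0"
    have "(\<rho> *v z c)$(i,j,k) = 0" for i j k
    proof -
      have "(\<rho> *v z c)$(i,j,k) = C (axis i 1) (axis j 1) c $ k"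
        using exhaust_2[of i] exhaust_2[of j] by (auto simp: C_def sum_2 axis_def)
      then show ?thesis by (simp add: 0)
    qed
    then have "\<rho> *v z c = 0" by (simp add: vec_eq_iff)
    moreover have "\<rho> *v axis r 1 = column r \<rho>" for r
      by (simp add: vec_eq_iff matrix_vector_mult_def column_def axis_def if_distrib cong: if_cong)
    then have "\<rho> *v z c = (\<Sum>t\<in>UNIV. c$t *s column (\<iota> t) \<rho>)"
      by (simp add: z_def sum_3 matrix_vector_right_distrib vector_scalar_commute)
    ultimately show "c = 0" using \<iota> by simp
  qed
  \<comment> \<open>The form is conjugate-linear on the left while \<open>C\<close> is linear, hence the conjugated vectors.\<close>
  have "det2 (vcnj a) (vcnj b) = cnj (det2 a b)" for a b by (simp add: det2_def vcnj_def)
  then have "common_vector (\<lambda>x k. vcnj (e x k)) (\<lambda>y l. vcnj (h y l))"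
    using e h by (intro common_vector_exists) auto
  then obtain k l v where v: "v \<noteq> 0" "\<And>x y. v \<in> range (C (vcnj (e x (k x))) (vcnj (h y (l y))))"
    unfolding common_vector_def by blast
  have form_z: "form \<rho> (tens a b u) (z c) = (\<Sum>i\<in>UNIV. cnj (u$i) * C (vcnj a) (vcnj b) c $ i)" for a b u c
  proof -
    have "form \<rho> (tens a b u) (z c) = (\<Sum>r\<in>UNIV. cnj (tens a b u $ r) * (\<rho> *v z c)$r)"
      by (simp add: form_def matrix_vector_mult_def sum_distrib_left mult.assoc)
    also have "\<dots> = (\<Sum>i\<in>UNIV. cnj (u$i) * C (vcnj a) (vcnj b) c $ i)"
      by (simp add: sum_triple tens_def C_def vcnj_def sum_2 algebra_simps)
    finally show ?thesis .
  qed
  have "\<exists>z. \<forall>u. form \<rho> (tens (e x (k x)) (h y (l y)) u) z = (\<Sum>i\<in>UNIV. cnj (u$i) * v$i)" for x y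
  proof -
    obtain c where "v = C (vcnj (e x (k x))) (vcnj (h y (l y))) c" using v(2) by blast
    then show ?thesis by (intro exI[of _ "z c"]) (simp add: form_z)
  qed
  with v(1) show ?thesis by blast
qed

text \<open>In the double sum over eigenvectors all terms are nonnegative, and the single term
  \<open>k\<close>, \<open>l\<close> already dominates a multiple of \<open>outer v\<close> by
  \<open>psd_ge_range\<close>. Allowing all smaller \<open>\<epsilon>'\<close> lets one constant
  serve every pair of settings.\<close>

lemma psd_steer_minus:
  fixes m n :: "2 \<Rightarrow> real"
  assumes "psd \<rho>" "\<And>k. m k \<ge> 0" "\<And>l. n l \<ge> 0" "m k > 0" "n l > 0"
    and z: "\<And>u. form \<rho> (tens (e k) (h l) u) z = (\<Sum>i\<in>UNIV. cnj (u$i) * v$i)"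
  shows "\<exists>\<epsilon>>0. \<forall>\<epsilon>'. \<epsilon>' \<le> \<epsilon> \<longrightarrow>
    psd (steer \<rho> (\<Sum>k\<in>UNIV. m k *\<^sub>R outer (e k)) (\<Sum>l\<in>UNIV. n l *\<^sub>R outer (h l)) - \<epsilon>' *\<^sub>R outer v)"
    (is "\<exists>\<epsilon>>0. \<forall>\<epsilon>'. _ \<longrightarrow> psd (?S - _)")
proof -
  obtain \<delta> :: real where \<delta>: "\<delta> > 0" "\<And>y. Re (form \<rho> y y) \<ge> \<delta> * (cmod (form \<rho> y z))\<^sup>2"
    using psd_ge_range[OF assms(1)] by blast
  have nn: "Re (form \<rho> y y) \<ge> 0" for y using assms(1) by (simp add: psd_form)
  define \<epsilon> where "\<epsilon> = m k * n l * \<delta>"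
  have "psd (?S - \<epsilon>' *\<^sub>R outer v)" if "\<epsilon>' \<le> \<epsilon>" for \<epsilon>'
    unfolding psd_form
  proof (intro allI conjI)
    fix u
    let ?F = "\<lambda>k l. Re (form \<rho> (tens (e k) (h l) u) (tens (e k) (h l) u))"
    let ?r = "(cmod (\<Sum>i\<in>UNIV. cnj (u$i) * v$i))\<^sup>2"
    have eq: "form (?S - \<epsilon>' *\<^sub>R outer v) u u = form ?S u u - of_real (\<epsilon>' * ?r)"
      by (simp add: form_diff form_scaleR form_outer)
    have "psd ?S" using assms by (intro psd_steer) auto
    then show "Im (form (?S - \<epsilon>' *\<^sub>R outer v) u u) = 0"
      unfolding eq psd_form by simp
    have "\<epsilon>' * ?r \<le> \<epsilon> * ?r" using that by (intro mult_right_mono) auto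
    also have "\<dots> \<le> m k * n l * ?F k l"
      using \<delta>(2)[of "tens (e k) (h l) u"] assms(4,5) by (simp add: z \<epsilon>_def mult.assoc)
    also have "\<dots> \<le> (\<Sum>l\<in>UNIV. m k * n l * ?F k l)"
      using assms nn by (intro member_le_sum) auto
    also have "\<dots> \<le> (\<Sum>k\<in>UNIV. \<Sum>l\<in>UNIV. m k * n l * ?F k l)"
      using assms nn by (intro member_le_sum[where f = "\<lambda>k. \<Sum>l\<in>UNIV. m k * n l * ?F k l"] sum_nonneg) auto
    also have "\<dots> = Re (form ?S u u)"
      unfolding form_steer_sum by (simp del: of_real_mult)
    finally show "0 \<le> Re (form (?S - \<epsilon>' *\<^sub>R outer v) u u)"
      unfolding eq by simp
  qed
  moreover have "\<epsilon> > 0" using assms \<delta> by (simp add: \<epsilon>_def)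
  ultimately show ?thesis by blast
qed

theorem theorem3:
  fixes \<rho> :: "complex^(2\<times>2\<times>2)^(2\<times>2\<times>2)"
    and M N :: "2 \<Rightarrow> 2 \<Rightarrow> complex^2^2"
  assumes "density \<rho>"
    and "\<And>x. povm (\<lambda>a. M a x)"
    and "\<And>y. povm (\<lambda>b. N b y)"
    and "rank \<rho> \<ge> 3"
  shows "no_signaling (\<lambda>a b x y. ptrace_AB (kron3_id (M a x) (N b y) ** \<rho>))
    \<and> \<not> on_edge (\<lambda>a b x y. ptrace_AB (kron3_id (M a x) (N b y) ** \<rho>))"
proof -
  have \<rho>: "psd \<rho>" using assms(1) by (simp add: density_def)
  obtain e m where "\<And>x. diagonalizes (\<lambda>a. M a x) (e x) (m x)"
    using qubit_povm_diagonalizable[OF assms(2)] by metis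
  then have e: "\<And>x. det2 (e x 1) (e x 2) \<noteq> 0"
    and m: "\<And>x a k. m x a k \<ge> 0" "\<And>x k. \<exists>a. m x a k > 0"
      "\<And>x a. M a x = (\<Sum>k\<in>UNIV. m x a k *\<^sub>R outer (e x k))"
    unfolding diagonalizes_def by blast+
  obtain h n where "\<And>y. diagonalizes (\<lambda>b. N b y) (h y) (n y)"
    using qubit_povm_diagonalizable[OF assms(3)] by metis
  then have h: "\<And>y. det2 (h y 1) (h y 2) \<noteq> 0"
    and n: "\<And>y b l. n y b l \<ge> 0" "\<And>y l. \<exists>b. n y b l > 0"
      "\<And>y b. N b y = (\<Sum>l\<in>UNIV. n y b l *\<^sub>R outer (h y l))"
    unfolding diagonalizes_def by blast+
  obtain k l v where v: "v \<noteq> 0" and "\<And>x y. \<exists>z. \<forall>u.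
      form \<rho> (tens (e x (k x)) (h y (l y)) u) z = (\<Sum>i\<in>UNIV. cnj (u$i) * v$i)"
    using steer_common_vector[of \<rho> e h, OF \<rho> assms(4) e h] by blast
  then obtain z where
    z: "\<And>x y u. form \<rho> (tens (e x (k x)) (h y (l y)) u) (z x y) = (\<Sum>i\<in>UNIV. cnj (u$i) * v$i)"
    by metis
  obtain f g where f: "\<And>x. m x (f x) (k x) > 0" and g: "\<And>y. n y (g y) (l y) > 0"
  proof -
    have "\<forall>x. \<exists>a. m x a (k x) > 0" "\<forall>y. \<exists>b. n y b (l y) > 0" using m(2) n(2) by blast+
    then show thesis using that by metis
  qed
  have "\<exists>\<epsilon>>0. \<forall>\<epsilon>'. \<epsilon>' \<le> \<epsilon> \<longrightarrow> psd (steer \<rho> (M (f x) x) (N (g y) y) - \<epsilon>' *\<^sub>R outer v)" for x y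
    unfolding m(3) n(3)
    using psd_steer_minus[of \<rho> "m x (f x)" "n y (g y)" "k x" "l y" "e x" "h y" "z x y" v]
      \<rho> m(1) n(1) f g z
    by blast
  then obtain \<epsilon> where \<epsilon>: "\<And>x y. \<epsilon> x y > 0"
    "\<And>x y \<epsilon>'. \<epsilon>' \<le> \<epsilon> x y \<Longrightarrow> psd (steer \<rho> (M (f x) x) (N (g y) y) - \<epsilon>' *\<^sub>R outer v)"
    by metis
  define r where "r = (\<Sum>i\<in>UNIV. (cmod (v$i))\<^sup>2)"
  \<comment> \<open>The minimum over settings gives one bound for all pairs, and
    \<open>1 / (2 * r)\<close> keeps the weight \<open>r * \<eta>\<close> of the normalized state
    below one.\<close>
  define \<eta> where "\<eta> = min (1 / (2 * r)) (Min (range (\<lambda>(x, y). \<epsilon> x y)))"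
  have dens: "density ((1 / r) *\<^sub>R outer v)" and r: "r > 0"
    unfolding r_def by (rule density_outer[OF v])+
  have "\<eta> > 0" using \<epsilon>(1) r by (auto simp: \<eta>_def)
  have "r * \<eta> \<le> r * (1 / (2 * r))" using r by (intro mult_left_mono) (auto simp: \<eta>_def)
  then have "r * \<eta> < 1" using r by simp
  have "\<eta> \<le> \<epsilon> x y" for x y
  proof -
    have "Min (range (\<lambda>(x, y). \<epsilon> x y)) \<le> \<epsilon> x y" by (intro Min_le) auto
    then show ?thesis by (simp add: \<eta>_def)
  qed
  then have "psd (steer \<rho> (M (f x) x) (N (g y) y) - (r * \<eta>) *\<^sub>R (1 / r) *\<^sub>R outer v)" for x y
    using \<epsilon>(2) r by simp
  from not_on_edge[OF steer_no_signaling[OF assms(1-3)] dens _ \<open>r * \<eta> < 1\<close> this] \<open>\<eta> > 0\<close> r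
    steer_no_signaling[OF assms(1-3)]
  show ?thesis unfolding steer_def by auto
qed

end
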